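(* Let $\mathcal F$ be a reproducing kernel Hilbert space (RKHS) of functions $\mathcal X\to\mathbb R$ with kernel $\mathcal K$ and norm $\|\cdot\|$, let $X\in\mathcal X^n$, $m\ge2$, $n=mp$, and let $K\in\mathbb R^{n\times n}$ be the Gram matrix $K_{ij}=\mathcal K(X_i,X_j)$. Then, for every $W\in\mathcal W$, $$M_{\mathrm P}^2(W)=\frac1{p^2}\max_{k\ne k'}\sum_{i,j=1}^n(w_{ik}-w_{ik'})K_{ij}(w_{jk}-w_{jk'}),$$ and, for every $Q=Q(\sigma)$ with $\sigma\in\Delta$, $$M_{\mathrm M}^2(Q)=\frac{2}{np}\,\lambda_{\max}\big(\sqrt K\,Q\,\sqrt K\big).$$
   Context: There are $n=mp$ subjects with covariates $X=(X_1,\dots,X_n)\in\mathcal X^n$ and $m$ treatments. $\mathcal W\subset\{1,\dots,m\}^n$ is the set of assignments $W$ with exactly $p$ subjects in each treatment; $w_{ik}=1$ if $W_i=k$ and $0$ otherwise. $\Delta$ is the set of probability distributions $\sigma$ on $\mathcal W$ with $\sigma((k_1,\dots,k_n))=\sigma((\pi(k_1),\dots,\pi(k_n)))$ for every permutation $\pi$ of $\{1,\dots,m\}$. For $f:\mathcal X\to\mathbb R$, $B_{kk'}(W,f)=\frac1p\sum_{i:W_i=k}f(X_i)-\frac1p\sum_{i:W_i=k'}f(X_i)$, and $$M_{\mathrm P}^2(W)=\max_{\|f\|\le1}\max_{k\ne k'}B_{kk'}^2(W,f),$$ where $f$ ranges over elements of $\mathcal F$ with $\|f\|\le 1$. For $\sigma\in\Delta$,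 $Q(\sigma)\in\mathbb R^{n\times n}$ is $$Q_{ij}(\sigma)=\sigma(\{W:W_i=W_j\})-\frac1{m-1}\sigma(\{W:W_i\ne W_j\}),$$ and $$M_{\mathrm M}^2(Q)=\max_{\|f\|\le1}\frac2{pn}\sum_{i,j=1}^nQ_{ij}f(X_i)f(X_j).$$ $\sqrt K$ is the positive semidefinite square root of $K$, and $\lambda_{\max}$ is the largest eigenvalue. *)

theory Defs
  imports "HOL-Probability.Probability" "HOL-Combinatorics.Permutations"
begin

text \<open>
  A Hilbert space of functions is given by its carrier \<open>F\<close>, closed under the pointwise
  operations, and its inner product \<open>ip\<close>, of which only the values on \<open>F\<close> matter.
\<close>

definition norm_of :: "(('x \<Rightarrow> real) \<Rightarrow> ('x \<Rightarrow> real) \<Rightarrow> real) \<Rightarrow> ('x \<Rightarrow> real) \<Rightarrow> real" where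
  "norm_of ip f = sqrt (ip f f)"

locale rkhs =
  fixes F :: "('x \<Rightarrow> real) set"
    and ip :: "('x \<Rightarrow> real) \<Rightarrow> ('x \<Rightarrow> real) \<Rightarrow> real"
    and kern :: "'x \<Rightarrow> 'x \<Rightarrow> real"
  assumes zero_mem: "(\<lambda>_. 0) \<in> F"
    and add_mem: "f \<in> F \<Longrightarrow> g \<in> F \<Longrightarrow> (\<lambda>x. f x + g x) \<in> F"
    and scale_mem: "f \<in> F \<Longrightarrow> (\<lambda>x. c * f x) \<in> F"
    and ip_commute: "f \<in> F \<Longrightarrow> g \<in> F \<Longrightarrow> ip f g = ip g f"
    and ip_add: "f \<in> F \<Longrightarrow> g \<in> F \<Longrightarrow> h \<in> F \<Longrightarrow> ip (\<lambda>x. f x + g x) h = ip f h + ip g h"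
    and ip_scale: "f \<in> F \<Longrightarrow> g \<in> F \<Longrightarrow> ip (\<lambda>x. c * f x) g = c * ip f g"
    and ip_nonneg: "f \<in> F \<Longrightarrow> 0 \<le> ip f f"
    and ip_definite: "f \<in> F \<Longrightarrow> ip f f = 0 \<Longrightarrow> f = (\<lambda>_. 0)"
    and complete:
      "(\<And>i::nat. u i \<in> F) \<Longrightarrow>
       (\<And>e. 0 < e \<Longrightarrow> \<exists>N. \<forall>i\<ge>N. \<forall>j\<ge>N. norm_of ip (\<lambda>x. u i x - u j x) < e) \<Longrightarrow>
       \<exists>f\<in>F. (\<lambda>i. norm_of ip (\<lambda>x. u i x - f x)) \<longlonglongrightarrow> 0"
    and kernel_mem: "(\<lambda>y. kern y x) \<in> F"
    and reproducing: "f \<in> F \<Longrightarrow> ip f (\<lambda>y. kern y x) = f x"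

definition closed_unit_ball ::
    "('x \<Rightarrow> real) set \<Rightarrow> (('x \<Rightarrow> real) \<Rightarrow> ('x \<Rightarrow> real) \<Rightarrow> real) \<Rightarrow> ('x \<Rightarrow> real) set" where
  "closed_unit_ball F ip = {f \<in> F. norm_of ip f \<le> 1}"

text \<open>
  The number \<open>maximum \<phi> S\<close> is meaningful only when \<open>has_maximum \<phi> S\<close>; on infinite sets
  this has to be asserted separately. The operator \<open>Max\<close> is used for finite sets.
\<close>

definition has_maximum :: "('b \<Rightarrow> real) \<Rightarrow> 'b set \<Rightarrow> bool" where
  "has_maximum \<phi> S \<longleftrightarrow> (\<exists>a\<in>S. \<forall>b\<in>S. \<phi> b \<le> \<phi> a)"

definition maximum :: "('b \<Rightarrow> real) \<Rightarrow> 'b set \<Rightarrow> real" where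
  "maximum \<phi> S = (GREATEST v. v \<in> \<phi> ` S)"

text \<open>
  Subjects are the elements of a finite type \<open>'n\<close>, so \<open>n = CARD('n)\<close>; treatments are the
  numbers \<open>1, \<dots>, m\<close>.
\<close>

definition assignments :: "nat \<Rightarrow> nat \<Rightarrow> ('n::finite \<Rightarrow> nat) set" where
  "assignments m p = {W. range W \<subseteq> {1..m} \<and> (\<forall>k\<in>{1..m}. card {i. W i = k} = p)}"

definition treatment_ind :: "('n \<Rightarrow> nat) \<Rightarrow> 'n \<Rightarrow> nat \<Rightarrow> real" where
  "treatment_ind W i k = (if W i = k then 1 else 0)"

definition treatment_pairs :: "nat \<Rightarrow> (nat \<times> nat) set" where
  "treatment_pairs m = {(k, k'). k \<in> {1..m} \<and> k' \<in> {1..m} \<and> k \<noteq> k'}"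

text \<open>The set \<open>\<Delta>\<close> of designs invariant under relabelling the treatments.\<close>

definition blind_designs :: "nat \<Rightarrow> nat \<Rightarrow> ('n::finite \<Rightarrow> nat) pmf set" where
  "blind_designs m p = {\<sigma>. set_pmf \<sigma> \<subseteq> assignments m p \<and>
     (\<forall>\<pi> W. \<pi> permutes {1..m} \<longrightarrow> W \<in> assignments m p \<longrightarrow> pmf \<sigma> (\<pi> \<circ> W) = pmf \<sigma> W)}"

definition imbalance ::
    "nat \<Rightarrow> ('n::finite \<Rightarrow> 'x) \<Rightarrow> ('n \<Rightarrow> nat) \<Rightarrow> ('x \<Rightarrow> real) \<Rightarrow> nat \<Rightarrow> nat \<Rightarrow> real" where
  "imbalance p X W f k k' =
     1 / real p * (\<Sum>i | W i = k. f (X i)) - 1 / real p * (\<Sum>i | W i = k'. f (X i))"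

definition worst_imbalance_sq ::
    "nat \<Rightarrow> nat \<Rightarrow> ('n::finite \<Rightarrow> 'x) \<Rightarrow> ('n \<Rightarrow> nat) \<Rightarrow> ('x \<Rightarrow> real) \<Rightarrow> real" where
  "worst_imbalance_sq m p X W f =
     (MAX (k, k')\<in>treatment_pairs m. (imbalance p X W f k k')\<^sup>2)"

definition M_P_sq ::
    "('x \<Rightarrow> real) set \<Rightarrow> (('x \<Rightarrow> real) \<Rightarrow> ('x \<Rightarrow> real) \<Rightarrow> real) \<Rightarrow>
     nat \<Rightarrow> nat \<Rightarrow> ('n::finite \<Rightarrow> 'x) \<Rightarrow> ('n \<Rightarrow> nat) \<Rightarrow> real" where
  "M_P_sq F ip m p X W = maximum (worst_imbalance_sq m p X W) (closed_unit_ball F ip)"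

definition Q_matrix :: "nat \<Rightarrow> ('n::finite \<Rightarrow> nat) pmf \<Rightarrow> real^'n^'n" where
  "Q_matrix m \<sigma> = (\<chi> i j. measure_pmf.prob \<sigma> {W. W i = W j}
     - 1 / (real m - 1) * measure_pmf.prob \<sigma> {W. W i \<noteq> W j})"

definition mixed_imbalance ::
    "nat \<Rightarrow> ('n::finite \<Rightarrow> 'x) \<Rightarrow> real^'n^'n \<Rightarrow> ('x \<Rightarrow> real) \<Rightarrow> real" where
  "mixed_imbalance p X Q f =
     2 / (real p * real CARD('n)) * (\<Sum>i\<in>UNIV. \<Sum>j\<in>UNIV. Q $ i $ j * f (X i) * f (X j))"

definition M_M_sq ::
    "('x \<Rightarrow> real) set \<Rightarrow> (('x \<Rightarrow> real) \<Rightarrow> ('x \<Rightarrow> real) \<Rightarrow> real) \<Rightarrow>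
     nat \<Rightarrow> ('n::finite \<Rightarrow> 'x) \<Rightarrow> real^'n^'n \<Rightarrow> real" where
  "M_M_sq F ip p X Q = maximum (mixed_imbalance p X Q) (closed_unit_ball F ip)"

definition gram :: "('x \<Rightarrow> 'x \<Rightarrow> real) \<Rightarrow> ('n::finite \<Rightarrow> 'x) \<Rightarrow> real^'n^'n" where
  "gram kern X = (\<chi> i j. kern (X i) (X j))"

definition pos_semidef :: "real^'n^'n \<Rightarrow> bool" where
  "pos_semidef A \<longleftrightarrow> transpose A = A \<and> (\<forall>v. 0 \<le> v \<bullet> (A *v v))"

definition mat_sqrt :: "real^'n^'n \<Rightarrow> real^'n^'n" where
  "mat_sqrt A = (THE S. pos_semidef S \<and> S ** S = A)"

definition eigenvalues :: "real^'n^'n \<Rightarrow> real set" where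
  "eigenvalues A = {l. \<exists>v. v \<noteq> 0 \<and> A *v v = l *\<^sub>R v}"

definition lambda_max :: "real^'n^'n \<Rightarrow> real" where
  "lambda_max A = Max (eigenvalues A)"

end

theory Submission
  imports Defs
begin

text \<open>
  Both objectives depend on \<open>f\<close> only through the sample vector \<open>z = (f(X\<^sub>1), \<dots>, f(X\<^sub>n))\<close>, so
  everything rests on knowing which vectors arise as \<open>f\<close> runs through the unit ball. Projecting
  \<open>f\<close> orthogonally onto the span of the kernel sections \<open>\<K>(\<cdot>, X\<^sub>i)\<close> keeps its samples and does not
  increase its norm (\<open>samples_interpolation\<close>), and a combination of sections with coefficients \<open>a\<close>
  has samples \<open>K a\<close> and squared norm \<open>a \<bullet> K a = \<parallel>\<surd>K a\<parallel>\<^sup>2\<close>. Hence the set of sample vectors is exactly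
  the image under \<open>\<surd>K\<close> of the Euclidean unit ball (\<open>samples_unit_ball\<close>), and both maxima become
  finite-dimensional.

  For pure strategies, an imbalance is \<open>c \<bullet> z / p\<close> with \<open>c\<close> the difference of two treatment indicator
  vectors, and the maximum of \<open>(c \<bullet> \<surd>K v)\<^sup>2\<close> over \<open>\<parallel>v\<parallel> \<le> 1\<close> is \<open>\<parallel>\<surd>K c\<parallel>\<^sup>2 = c \<bullet> K c\<close> by
  Cauchy-Schwarz (\<open>linear_form_on_unit_ball\<close>). The maxima over \<open>f\<close> and over the finitely many pairs
  of treatments may be taken in either order.

  For mixed strategies, the objective is a multiple of \<open>z \<bullet> Q z = v \<bullet> (\<surd>K Q \<surd>K) v\<close>. Over the whole
  unit ball, rather than the sphere, the maximum of such a form is \<open>\<lambda>\<^sub>m\<^sub>a\<^sub>x\<close> only if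
  \<open>\<lambda>\<^sub>m\<^sub>a\<^sub>x \<ge> 0\<close>: otherwise \<open>v = 0\<close> does better. This holds because \<open>Q\<close> is positive semidefinite,
  being an average of matrices that are so for each single assignment (\<open>matching_quadratic_form\<close>).

  The matrix analysis behind \<open>\<surd>K\<close> and \<open>\<lambda>\<^sub>m\<^sub>a\<^sub>x\<close> is the spectral theorem for real symmetric matrices,
  obtained from maximization of the Rayleigh quotient (\<open>self_adjoint_eigenbasis\<close>).
\<close>

section \<open>The spectral theorem for self-adjoint operators\<close>

definition self_adjoint :: "('a::real_inner \<Rightarrow> 'a) \<Rightarrow> bool" where
  "self_adjoint f \<longleftrightarrow> linear f \<and> (\<forall>x y. f x \<bullet> y = x \<bullet> f y)"

text \<open>
  For a unit eigenvector \<open>b\<close> the eigenvalue is necessarily \<open>b \<bullet> f b\<close>, so it need not be carried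
  along as separate data.
\<close>

definition orthonormal_eigenvectors :: "('a::real_inner \<Rightarrow> 'a) \<Rightarrow> 'a set \<Rightarrow> bool" where
  "orthonormal_eigenvectors f B \<longleftrightarrow>
     pairwise orthogonal B \<and> (\<forall>b\<in>B. norm b = 1 \<and> f b = (b \<bullet> f b) *\<^sub>R b)"

lemma self_adjoint_linear: "self_adjoint f \<Longrightarrow> linear f"
  and self_adjoint_commute: "self_adjoint f \<Longrightarrow> f x \<bullet> y = x \<bullet> f y"
  by (auto simp: self_adjoint_def)

text \<open>
  The Rayleigh quotient attains its maximum \<open>l\<close> on the unit sphere of \<open>V\<close> by compactness, and a
  maximizer \<open>u\<close> is an eigenvector: moving from \<open>u\<close> in the direction of the residual
  \<open>w = f u - l u\<close>, which lies in \<open>V\<close> and is orthogonal to \<open>u\<close>, would otherwise increase the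
  quotient to first order.
\<close>

lemma self_adjoint_eigenvector_in_subspace:
  fixes f :: "'a::euclidean_space \<Rightarrow> 'a"
  assumes f: "self_adjoint f"
    and V: "subspace V" "\<And>v. v \<in> V \<Longrightarrow> f v \<in> V" "V \<noteq> {0}"
  obtains u where "u \<in> V" "norm u = 1" "f u = (u \<bullet> f u) *\<^sub>R u"
proof -
  note lin = self_adjoint_linear[OF f]
  have "0 \<in> V" using V(1) by (rule subspace_0)
  then obtain v0 where v0: "v0 \<in> V" "v0 \<noteq> 0" using V(3) by blast
  have "v0 /\<^sub>R norm v0 \<in> V \<inter> sphere 0 1"
    using v0 V(1) by (simp add: subspace_scale)
  then have ne: "V \<inter> sphere 0 1 \<noteq> {}" by blast
  have comp: "compact (V \<inter> sphere 0 1)"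
    using closed_subspace[OF V(1)] by (simp add: closed_Int_compact)
  have cont: "continuous_on (V \<inter> sphere 0 1) (\<lambda>v. v \<bullet> f v)"
    by (intro continuous_intros linear_continuous_on lin[unfolded linear_conv_bounded_linear])
  obtain u where u: "u \<in> V" "norm u = 1"
    and max: "\<And>v. v \<in> V \<Longrightarrow> norm v = 1 \<Longrightarrow> v \<bullet> f v \<le> u \<bullet> f u"
    using continuous_attains_sup[OF comp ne cont] by auto
  define l where "l = u \<bullet> f u"
  have rayleigh: "v \<bullet> f v \<le> l * (v \<bullet> v)" if "v \<in> V" for v
  proof (cases "v = 0")
    case True then show ?thesis using linear_0[OF lin] by simp
  next
    case False
    have "(v /\<^sub>R norm v) \<bullet> f (v /\<^sub>R norm v) \<le> l"
      unfolding l_def using that False V(1) by (intro max) (simp_all add: subspace_scale)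
    then have "(v \<bullet> f v) / (norm v)\<^sup>2 \<le> l"
      by (simp add: linear_scale[OF lin] power2_eq_square field_simps)
    then show ?thesis using False by (simp add: divide_simps power2_norm_eq_inner mult.commute)
  qed
  define w where "w = f u - l *\<^sub>R u"
  have "w \<in> V" using u V by (simp add: w_def subspace_diff subspace_scale)
  have uu: "u \<bullet> u = 1" using u by (simp add: norm_eq_1)
  have uw: "u \<bullet> w = 0" by (simp add: w_def inner_diff_right uu l_def)
  have fuw: "w \<bullet> f u = w \<bullet> w"
    using uw by (simp add: w_def inner_diff_right inner_commute)
  define c where "c = l * (w \<bullet> w) - w \<bullet> f w"
  have ineq: "2 * t * (w \<bullet> w) \<le> t\<^sup>2 * c" for t
  proof -
    have "u + t *\<^sub>R w \<in> V" using u V(1) \<open>w \<in> V\<close> by (simp add: subspace_add subspace_scale)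
    from rayleigh[OF this]
    have "l + 2 * t * (w \<bullet> f u) + t\<^sup>2 * (w \<bullet> f w) \<le> l * (1 + t\<^sup>2 * (w \<bullet> w))"
      using self_adjoint_commute[OF f, of u w] uw uu
      by (simp add: linear_add[OF lin] linear_scale[OF lin] inner_add_left inner_add_right
          l_def inner_commute power2_eq_square algebra_simps)
    then show ?thesis by (simp add: fuw c_def algebra_simps)
  qed
  \<comment> \<open>The left-hand side is linear in \<open>t\<close> and the right-hand side quadratic, so a small positive
    \<open>t\<close>, here \<open>(w \<bullet> w) / (1 + \<bar>c\<bar>)\<close>, refutes \<open>w \<noteq> 0\<close>.\<close>
  have "w \<bullet> w \<le> 0"
  proof (rule ccontr)
    assume *: "\<not> w \<bullet> w \<le> 0"
    have "2 * (w \<bullet> w) \<le> t * c" if "0 < t" for t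
      using ineq[of t] that by (simp add: power2_eq_square)
    moreover have "0 < (w \<bullet> w) / (1 + \<bar>c\<bar>)"
      using * by (intro divide_pos_pos) linarith+
    ultimately have "2 * (w \<bullet> w) \<le> (w \<bullet> w) / (1 + \<bar>c\<bar>) * c" by blast
    also have "\<dots> = (w \<bullet> w) * (c / (1 + \<bar>c\<bar>))" by simp
    also have "\<dots> \<le> (w \<bullet> w) * 1"
      by (intro mult_left_mono) (auto simp: divide_simps)
    finally show False using * by simp
  qed
  then have "w = 0" using inner_gt_zero_iff not_le by blast
  then show thesis using that[of u] u by (simp add: w_def l_def)
qed

text \<open>
  Take an orthonormal set of eigenvectors of maximal cardinality. Its orthogonal complement is
  invariant under \<open>f\<close>, so if the complement were nonzero it would contain a further eigenvector.
\<close>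

theorem self_adjoint_eigenbasis:
  fixes f :: "'a::euclidean_space \<Rightarrow> 'a"
  assumes f: "self_adjoint f"
  obtains B where "finite B" "orthonormal_eigenvectors f B" "span B = UNIV"
proof -
  have bound: "finite B \<and> card B \<le> DIM('a)" if "orthonormal_eigenvectors f B" for B
  proof -
    have "0 \<notin> B" using that by (auto simp: orthonormal_eigenvectors_def)
    then have "independent B"
      using that by (intro pairwise_orthogonal_independent) (auto simp: orthonormal_eigenvectors_def)
    then show ?thesis using independent_bound by blast
  qed
  have "orthonormal_eigenvectors f {}" by (simp add: orthonormal_eigenvectors_def)
  then obtain B where B: "orthonormal_eigenvectors f B"
    and max: "\<And>C. orthonormal_eigenvectors f C \<Longrightarrow> card C \<le> card B"
    using ex_has_greatest_nat[of "orthonormal_eigenvectors f" "{}" card "Suc DIM('a)"] bound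
    by (metis le_imp_less_Suc)
  have "finite B" using bound[OF B] by simp
  define V where "V = {y. \<forall>b\<in>B. orthogonal b y}"
  have sub: "subspace V" unfolding V_def by (rule subspace_orthogonal_to_vectors)
  have inv: "f v \<in> V" if "v \<in> V" for v
    unfolding V_def
  proof (intro CollectI ballI)
    fix b assume "b \<in> B"
    then have eig: "f b = (b \<bullet> f b) *\<^sub>R b" and "b \<bullet> v = 0"
      using B that by (auto simp: orthonormal_eigenvectors_def V_def orthogonal_def)
    have "b \<bullet> f v = f b \<bullet> v" using self_adjoint_commute[OF f] by simp
    also have "\<dots> = (b \<bullet> f b) * (b \<bullet> v)" by (subst eig) simp
    finally show "orthogonal b (f v)" using \<open>b \<bullet> v = 0\<close> by (simp add: orthogonal_def)
  qed
  have V0: "V = {0}"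
  proof (rule ccontr)
    assume "V \<noteq> {0}"
    then obtain u where u: "u \<in> V" "norm u = 1" "f u = (u \<bullet> f u) *\<^sub>R u"
      using self_adjoint_eigenvector_in_subspace[OF f sub inv] by blast
    have "u \<notin> B" using u by (auto simp: V_def orthogonal_self)
    have "orthonormal_eigenvectors f (insert u B)"
      using B u by (auto simp: orthonormal_eigenvectors_def V_def orthogonal_commute
          intro!: pairwise_orthogonal_insert)
    from max[OF this] show False using \<open>u \<notin> B\<close> \<open>finite B\<close> by simp
  qed
  have "x \<in> span B" for x
  proof -
    obtain y z where yz: "y \<in> span B" "\<And>w. w \<in> span B \<Longrightarrow> orthogonal z w" "x = y + z"
      using orthogonal_subspace_decomp_exists[of B x] by blast
    have "z \<in> V" using yz(2) by (auto simp: V_def span_base orthogonal_commute)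
    then show ?thesis using V0 yz by simp
  qed
  then show thesis using that[OF \<open>finite B\<close> B] by blast
qed

lemma eigenbasis_expand:
  fixes f :: "'a::euclidean_space \<Rightarrow> 'a"
  assumes "finite B" "orthonormal_eigenvectors f B" "span B = UNIV"
  shows "(\<Sum>b\<in>B. (x \<bullet> b) *\<^sub>R b) = x"
  using assms by (intro orthonormal_basis_expand) (auto simp: orthonormal_eigenvectors_def)

lemma eigenbasis_parseval:
  fixes f :: "'a::euclidean_space \<Rightarrow> 'a"
  assumes "finite B" "orthonormal_eigenvectors f B" "span B = UNIV"
  shows "(\<Sum>b\<in>B. (x \<bullet> b) * (y \<bullet> b)) = x \<bullet> y"
proof -
  have "x \<bullet> y = (\<Sum>b\<in>B. (x \<bullet> b) *\<^sub>R b) \<bullet> y" using eigenbasis_expand[OF assms] by simp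
  also have "\<dots> = (\<Sum>b\<in>B. (x \<bullet> b) * (y \<bullet> b))" by (simp add: inner_sum_left inner_commute[of y])
  finally show ?thesis by simp
qed

section \<open>Largest eigenvalue and square root of a symmetric matrix\<close>

lemma self_adjoint_matrix:
  fixes A :: "real^'n^'n"
  assumes "transpose A = A"
  shows "self_adjoint ((*v) A)"
  unfolding self_adjoint_def
  using assms by (metis dot_lmul_matrix matrix_vector_mul_linear transpose_matrix_vector)

text \<open>
  In coordinates of an eigenbasis the form is \<open>\<Sum>\<^sub>b l\<^sub>b (v \<bullet> b)\<^sup>2\<close>. The eigenbasis also shows that there are only
  finitely many eigenvalues, all of them of the form \<open>l\<^sub>b\<close>, which is what makes the \<open>Max\<close> in
  \<^const>\<open>lambda_max\<close> meaningful.
\<close>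

lemma lambda_max_quadratic_form:
  fixes A :: "real^'n^'n"
  assumes A: "transpose A = A"
  shows "\<exists>u. norm u = 1 \<and> u \<bullet> (A *v u) = lambda_max A"
    and "v \<bullet> (A *v v) \<le> lambda_max A * (norm v)\<^sup>2"
proof -
  note sa = self_adjoint_matrix[OF A]
  obtain B where B: "finite B" "orthonormal_eigenvectors ((*v) A) B" "span B = UNIV"
    using self_adjoint_eigenbasis[OF sa] .
  define l where "l = (\<lambda>b. b \<bullet> (A *v b))"
  have eig: "A *v b = l b *\<^sub>R b" "norm b = 1" if "b \<in> B" for b
    using B(2) that by (auto simp: orthonormal_eigenvectors_def l_def)
  \<comment> \<open>The space contains a nonzero vector, so the basis is nonempty.\<close>
  have "(axis undefined 1 :: real^'n) \<noteq> 0" by (simp add: axis_eq_0_iff)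
  then have "B \<noteq> {}" using B(3) by (metis UNIV_I singletonD span_empty)
  have Avb: "(A *v v) \<bullet> b = l b * (v \<bullet> b)" if "b \<in> B" for b v
    using self_adjoint_commute[OF sa, of v b] eig[OF that] by simp
  have eigs: "eigenvalues A = l ` B"
  proof (intro equalityI subsetI)
    fix c assume "c \<in> eigenvalues A"
    then obtain v where v: "v \<noteq> 0" "A *v v = c *\<^sub>R v" by (auto simp: eigenvalues_def)
    obtain b where b: "b \<in> B" "v \<bullet> b \<noteq> 0"
      using eigenbasis_expand[OF B, of v] v(1) by (metis (no_types, lifting) scale_zero_left sum.neutral)
    then have "c = l b" using Avb[OF b(1), of v] v(2) by simp
    then show "c \<in> l ` B" using b by blast
  next
    fix c assume "c \<in> l ` B"
    then obtain b where b: "b \<in> B" "c = l b" by blast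
    then have "b \<noteq> 0" using eig(2) by fastforce
    then show "c \<in> eigenvalues A" unfolding eigenvalues_def using eig(1)[OF b(1)] b(2) by blast
  qed
  then have lmax: "lambda_max A = Max (l ` B)" by (simp add: lambda_max_def)
  have "lambda_max A \<in> l ` B" unfolding lmax using B(1) \<open>B \<noteq> {}\<close> by simp
  then obtain u where "u \<in> B" "lambda_max A = l u" by blast
  then have "norm u = 1 \<and> u \<bullet> (A *v u) = lambda_max A" using eig(2) by (simp add: l_def)
  then show "\<exists>u. norm u = 1 \<and> u \<bullet> (A *v u) = lambda_max A" ..
  have "v \<bullet> (A *v v) = (\<Sum>b\<in>B. (v \<bullet> b) * ((A *v v) \<bullet> b))"
    by (simp add: eigenbasis_parseval[OF B])
  also have "\<dots> = (\<Sum>b\<in>B. l b * (v \<bullet> b)\<^sup>2)"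
    by (intro sum.cong) (simp_all add: Avb power2_eq_square)
  also have "\<dots> \<le> (\<Sum>b\<in>B. lambda_max A * (v \<bullet> b)\<^sup>2)"
    unfolding lmax using B(1) by (intro sum_mono mult_right_mono) auto
  also have "\<dots> = lambda_max A * (norm v)\<^sup>2"
    using eigenbasis_parseval[OF B, of v v]
    by (simp add: power2_norm_eq_inner power2_eq_square[of "_ \<bullet> _"] flip: sum_distrib_left)
  finally show "v \<bullet> (A *v v) \<le> lambda_max A * (norm v)\<^sup>2" .
qed

text \<open>
  From \<open>(S + \<surd>l) (S - \<surd>l) b = 0\<close>, the vector \<open>u = (S - \<surd>l) b\<close> satisfies \<open>S u = - \<surd>l u\<close>. For
  \<open>l > 0\<close> positivity of \<open>S\<close> forces \<open>u = 0\<close>; for \<open>l = 0\<close> symmetry does, as \<open>u \<bullet> u = b \<bullet> S u = 0\<close>.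
  Any positive semidefinite root is therefore determined on an eigenbasis of \<open>A\<close>, which gives
  uniqueness below.
\<close>

lemma psd_root_eigenvector:
  fixes A S :: "real^'n^'n"
  assumes S: "pos_semidef S" "S ** S = A" and b: "A *v b = l *\<^sub>R b" and "0 \<le> l"
  shows "S *v b = sqrt l *\<^sub>R b"
proof -
  define u where "u = S *v b - sqrt l *\<^sub>R b"
  have sa: "self_adjoint ((*v) S)" using S(1) by (simp add: pos_semidef_def self_adjoint_matrix)
  have "S *v (S *v b) = l *\<^sub>R b" using S(2) b by (simp add: matrix_vector_mul_assoc)
  then have Su: "S *v u = - sqrt l *\<^sub>R u"
    using \<open>0 \<le> l\<close> by (simp add: u_def matrix_vector_mult_diff_distrib matrix_vector_mult_scaleR
        scaleR_diff_right)
  have "u = 0"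
  proof (cases "l = 0")
    case True
    then have "u \<bullet> u = b \<bullet> (S *v u)"
      using self_adjoint_commute[OF sa, of b u] by (simp add: u_def)
    then show ?thesis using Su True by simp
  next
    case False
    have "0 \<le> u \<bullet> (S *v u)" using S(1) by (simp add: pos_semidef_def)
    then have "sqrt l * (u \<bullet> u) \<le> 0" by (simp add: Su)
    moreover have "0 < sqrt l" using False \<open>0 \<le> l\<close> by simp
    ultimately have "\<not> 0 < u \<bullet> u" using mult_pos_pos not_le by blast
    then show ?thesis using inner_gt_zero_iff by blast
  qed
  then show ?thesis by (simp add: u_def)
qed

text \<open>
  The root takes the square roots of the eigenvalues on an eigenbasis of \<open>A\<close>. A matrix is
  determined by its values on that basis, so both \<open>S ** S = A\<close> and uniqueness are checked there.
\<close>

lemma psd_root_exists1: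
  fixes A :: "real^'n^'n"
  assumes A: "pos_semidef A"
  shows "\<exists>!S. pos_semidef S \<and> S ** S = A"
proof -
  have sa: "self_adjoint ((*v) A)" using A by (simp add: pos_semidef_def self_adjoint_matrix)
  obtain B where B: "finite B" "orthonormal_eigenvectors ((*v) A) B" "span B = UNIV"
    using self_adjoint_eigenbasis[OF sa] .
  define l where "l = (\<lambda>b. b \<bullet> (A *v b))"
  have l0: "0 \<le> l b" for b using A by (simp add: l_def pos_semidef_def)
  have eig: "A *v b = l b *\<^sub>R b" "norm b = 1" if "b \<in> B" for b
    using B(2) that by (auto simp: orthonormal_eigenvectors_def l_def)
  have orth: "b \<bullet> c = (if b = c then 1 else 0)" if "b \<in> B" "c \<in> B" for b c
    using B(2) that by (auto simp: orthonormal_eigenvectors_def pairwise_def orthogonal_def norm_eq_1)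
  have ext: "M = N" if "\<And>b. b \<in> B \<Longrightarrow> M *v b = N *v b" for M N :: "real^'n^'n"
  proof -
    have "M *v x = N *v x" for x
      by (rule linear_eq_on[OF matrix_vector_mul_linear matrix_vector_mul_linear, where B = B])
        (use B(3) that in auto)
    then show ?thesis by (simp add: matrix_eq)
  qed
  define s where "s = (\<lambda>v. \<Sum>b\<in>B. (sqrt (l b) * (v \<bullet> b)) *\<^sub>R b)"
  have lin: "linear s"
    by (rule linearI) (simp_all add: s_def inner_add_left algebra_simps sum.distrib scaleR_sum_right)
  define S where "S = matrix s"
  have Sv: "S *v v = s v" for v unfolding S_def using matrix_vector_mul(2)[OF lin] by metis
  have Sb: "S *v b = sqrt (l b) *\<^sub>R b" if "b \<in> B" for b
  proof -
    have "s b = (\<Sum>c\<in>B. if c = b then sqrt (l b) *\<^sub>R b else 0)"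
      unfolding s_def using that by (intro sum.cong) (auto simp: orth)
    then show ?thesis using that B(1) by (simp add: Sv)
  qed
  have form: "x \<bullet> (S *v y) = (\<Sum>b\<in>B. sqrt (l b) * ((x \<bullet> b) * (y \<bullet> b)))" for x y
    by (simp add: Sv s_def inner_sum_right mult_ac)
  have "x \<bullet> (transpose S *v y) = x \<bullet> (S *v y)" for x y
    using form[of x y] form[of y x] by (simp add: dot_lmul_matrix inner_commute[of x "y v* S"] mult_ac)
  then have "transpose S *v y = S *v y" for y
    by (metis vector_eq_rdot inner_commute)
  then have "transpose S = S" by (simp only: matrix_eq) simp
  moreover have "0 \<le> x \<bullet> (S *v x)" for x
    by (simp add: form l0 sum_nonneg)
  moreover have "S ** S = A"
    by (rule ext) (simp add: matrix_vector_mul_assoc[symmetric] Sb eig matrix_vector_mult_scaleR l0)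
  ultimately have "pos_semidef S \<and> S ** S = A" by (simp add: pos_semidef_def)
  moreover have "T = S" if "pos_semidef T \<and> T ** T = A" for T
    using that psd_root_eigenvector[OF _ _ eig(1) l0] by (intro ext) (metis Sb)
  ultimately show ?thesis by blast
qed

lemma mat_sqrt_symmetric_root:
  fixes A :: "real^'n^'n"
  assumes "pos_semidef A"
  shows "transpose (mat_sqrt A) = mat_sqrt A" "mat_sqrt A ** mat_sqrt A = A"
  using theI'[OF psd_root_exists1[OF assms]] by (auto simp: mat_sqrt_def pos_semidef_def)

text \<open>For a symmetric matrix the kernel is the orthogonal complement of the range.\<close>

lemma symmetric_range_kernel_decomposition:
  fixes A :: "real^'n^'n"
  assumes A: "transpose A = A"
  obtains a w where "v = A *v a + w" "A *v w = 0"
proof -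
  have "subspace (range ((*v) A))"
    by (intro linear_subspace_image matrix_vector_mul_linear subspace_UNIV)
  then have span: "span (range ((*v) A)) = range ((*v) A)" by (simp add: span_eq_iff)
  obtain y w where yw: "y \<in> range ((*v) A)" "\<And>x. x \<in> range ((*v) A) \<Longrightarrow> orthogonal w x" "v = y + w"
    using orthogonal_subspace_decomp_exists[of "range ((*v) A)" v] unfolding span by blast
  have "(A *v w) \<bullet> (A *v w) = w \<bullet> (A *v (A *v w))"
    by (rule self_adjoint_commute[OF self_adjoint_matrix[OF A]])
  also have "\<dots> = 0" using yw(2) by (auto simp: orthogonal_def)
  finally have "A *v w = 0" by simp
  then show thesis using that yw by blast
qed

section \<open>Sampling the unit ball of a reproducing kernel Hilbert space\<close>

definition kernel_combination :: "('x \<Rightarrow> 'x \<Rightarrow> real) \<Rightarrow> ('n::finite \<Rightarrow> 'x) \<Rightarrow> real^'n \<Rightarrow> 'x \<Rightarrow> real" where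
  "kernel_combination kern X a = (\<lambda>y. \<Sum>i\<in>UNIV. a $ i * kern y (X i))"

definition samples :: "('n \<Rightarrow> 'x) \<Rightarrow> ('x \<Rightarrow> real) \<Rightarrow> real^'n" where
  "samples X f = (\<chi> i. f (X i))"

context rkhs
begin

lemma ip_zero: "g \<in> F \<Longrightarrow> ip (\<lambda>_. 0) g = 0"
  using ip_scale[of g g 0] by simp

text \<open>
  Membership and the inner product are proved together, since the additivity of \<open>ip\<close> used in the
  induction step is available only for members of \<open>F\<close>.
\<close>

lemma kernel_sum:
  assumes "finite I"
  shows "(\<lambda>y. \<Sum>i\<in>I. c i * kern y (x i)) \<in> F \<and>
    (\<forall>f\<in>F. ip (\<lambda>y. \<Sum>i\<in>I. c i * kern y (x i)) f = (\<Sum>i\<in>I. c i * f (x i)))"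
  using assms
proof (induction I)
  case empty
  then show ?case by (simp add: zero_mem ip_zero)
next
  case (insert j I)
  have k: "(\<lambda>y. c j * kern y (x j)) \<in> F" by (rule scale_mem[OF kernel_mem])
  have "ip (\<lambda>y. c j * kern y (x j)) f = c j * f (x j)" if "f \<in> F" for f
    using that by (simp add: ip_scale kernel_mem ip_commute[of _ f] reproducing)
  with insert k show ?case by (simp add: add_mem ip_add)
qed

lemma kernel_combination_mem: "kernel_combination kern X a \<in> F"
  unfolding kernel_combination_def using kernel_sum[OF finite, where c = "($) a"] by blast

lemma ip_kernel_combination:
  "f \<in> F \<Longrightarrow> ip (kernel_combination kern X a) f = a \<bullet> samples X f"
  unfolding kernel_combination_def using kernel_sum[OF finite, where c = "($) a" and x = X]
  by (simp add: inner_vec_def samples_def)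

lemma samples_kernel_combination:
  "samples X (kernel_combination kern X a) = gram kern X *v a"
  by (simp add: vec_eq_iff samples_def kernel_combination_def gram_def matrix_vector_mult_def mult.commute)

lemma ip_kernel_combination_self:
  "ip (kernel_combination kern X a) (kernel_combination kern X a) = a \<bullet> (gram kern X *v a)"
  by (simp add: ip_kernel_combination kernel_combination_mem samples_kernel_combination)

lemma pos_semidef_gram: "pos_semidef (gram kern X)"
proof -
  have "kern x y = kern y x" for x y
    using reproducing[OF kernel_mem, of x y] reproducing[OF kernel_mem, of y x]
      ip_commute[OF kernel_mem kernel_mem, of x y] by simp
  then have "transpose (gram kern X) = gram kern X"
    by (simp add: vec_eq_iff transpose_def gram_def)
  moreover have "0 \<le> v \<bullet> (gram kern X *v v)" for v
    using ip_nonneg[OF kernel_combination_mem, of X v] by (simp add: ip_kernel_combination_self)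
  ultimately show ?thesis by (simp add: pos_semidef_def)
qed

text \<open>
  The orthogonal projection of \<open>f\<close> onto the span of the kernel sections at the points \<open>X\<^sub>i\<close>. Its
  coefficients \<open>a\<close> solve \<open>K a = z\<close> for the sample vector \<open>z\<close> of \<open>f\<close>. This system is solvable even
  for singular \<open>K\<close>: if \<open>K w = 0\<close>, then the combination with coefficients \<open>w\<close> has norm zero, hence
  vanishes, and pairing it with \<open>f\<close> gives \<open>w \<bullet> z = 0\<close>.
\<close>

lemma samples_interpolation:
  assumes f: "f \<in> F"
  obtains a where "samples X f = gram kern X *v a" "a \<bullet> (gram kern X *v a) \<le> ip f f"
proof -
  let ?K = "gram kern X" and ?g = "kernel_combination kern X"
  have sym: "transpose ?K = ?K" using pos_semidef_gram[of X] by (simp add: pos_semidef_def)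
  obtain a w where aw: "samples X f = ?K *v a + w" "?K *v w = 0"
    using symmetric_range_kernel_decomposition[OF sym] .
  have "ip (?g w) (?g w) = 0" using aw(2) by (simp add: ip_kernel_combination_self)
  then have "?g w = (\<lambda>_. 0)" using ip_definite kernel_combination_mem by blast
  then have "w \<bullet> samples X f = 0" using ip_kernel_combination[OF f, of X w] ip_zero[OF f] by simp
  moreover have "w \<bullet> (?K *v a) = 0"
    using self_adjoint_commute[OF self_adjoint_matrix[OF sym], of w a] aw(2) by simp
  ultimately have "w = 0" using aw(1) by (simp add: inner_add_right)
  then have z: "samples X f = ?K *v a" using aw by simp
  \<comment> \<open>The difference from the projection has zero samples, so it is orthogonal to all sections, and
    Pythagoras compares the norms.\<close>
  define h where "h = (\<lambda>x. f x + (-1) * ?g a x)"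
  have hF: "h \<in> F" unfolding h_def by (intro add_mem scale_mem f kernel_combination_mem)
  have gh: "ip (?g a) h = 0"
  proof -
    have "samples X h = samples X f - samples X (?g a)" by (simp add: samples_def h_def vec_eq_iff)
    then show ?thesis using hF by (simp add: ip_kernel_combination samples_kernel_combination z)
  qed
  have feq: "f = (\<lambda>x. ?g a x + h x)" by (simp add: h_def)
  have "ip f f = ip (?g a) f + ip h f"
    using ip_add[OF kernel_combination_mem hF f, of X a] feq by simp
  also have "ip (?g a) f = ip (?g a) (?g a)"
    by (simp add: ip_kernel_combination f kernel_combination_mem samples_kernel_combination z)
  also have "ip h f = ip f h" by (rule ip_commute[OF hF f])
  also have "ip f h = ip (?g a) h + ip h h"
    using ip_add[OF kernel_combination_mem hF hF, of X a] feq by simp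
  finally have "ip (?g a) (?g a) \<le> ip f f" using gh ip_nonneg[OF hF] by simp
  then show thesis using that z by (simp add: ip_kernel_combination_self)
qed

text \<open>
  Writing \<open>S = \<surd>K\<close>, a sample vector \<open>K a = S (S a)\<close> has preimage \<open>S a\<close>, whose norm is that of the
  interpolating combination. Conversely a vector \<open>v\<close> splits as \<open>S a + w\<close> with \<open>S w = 0\<close>, and
  discarding \<open>w\<close> changes neither \<open>S v\<close> nor the bound on the norm.
\<close>

theorem samples_unit_ball:
  fixes X :: "'n::finite \<Rightarrow> 'x"
  defines "S \<equiv> mat_sqrt (gram kern X)"
  shows "samples X ` closed_unit_ball F ip = (*v) S ` cball 0 1"
proof -
  have S: "transpose S = S" "S ** S = gram kern X"
    unfolding S_def using mat_sqrt_symmetric_root[OF pos_semidef_gram] by blast+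
  note com = self_adjoint_commute[OF self_adjoint_matrix[OF S(1)]]
  have K: "gram kern X *v a = S *v (S *v a)" for a
    by (simp add: matrix_vector_mul_assoc S(2))
  have aKa: "a \<bullet> (gram kern X *v a) = (norm (S *v a))\<^sup>2" for a
    by (simp add: K com[symmetric] power2_norm_eq_inner)
  show ?thesis
  proof (intro equalityI subsetI)
    fix z assume "z \<in> samples X ` closed_unit_ball F ip"
    then obtain f where f: "f \<in> F" "ip f f \<le> 1" "z = samples X f"
      by (auto simp: closed_unit_ball_def norm_of_def)
    obtain a where a: "samples X f = gram kern X *v a" "a \<bullet> (gram kern X *v a) \<le> ip f f"
      using samples_interpolation[OF f(1)] .
    have "(norm (S *v a))\<^sup>2 \<le> 1" using a(2) f(2) by (simp add: aKa)
    then have "norm (S *v a) \<le> 1" by (simp add: power_le_one_iff abs_square_le_1)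
    then show "z \<in> (*v) S ` cball 0 1" using f(3) a(1) K by auto
  next
    fix z assume "z \<in> (*v) S ` cball 0 1"
    then obtain v where v: "norm v \<le> 1" "z = S *v v" by auto
    obtain a w where aw: "v = S *v a + w" "S *v w = 0"
      using symmetric_range_kernel_decomposition[OF S(1)] .
    have "(S *v a) \<bullet> w = 0" by (simp add: com aw(2))
    then have "(norm v)\<^sup>2 = (norm (S *v a))\<^sup>2 + (norm w)\<^sup>2"
      unfolding aw(1) by (intro norm_add_Pythagorean) (simp add: orthogonal_def)
    moreover have "(norm v)\<^sup>2 \<le> 1" using v(1) by (simp add: abs_square_le_1)
    ultimately have "(norm (S *v a))\<^sup>2 \<le> 1" by (smt (verit) zero_le_power2)
    then have "kernel_combination kern X a \<in> closed_unit_ball F ip"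
      by (simp add: closed_unit_ball_def norm_of_def kernel_combination_mem ip_kernel_combination_self aKa)
    moreover have "z = samples X (kernel_combination kern X a)"
      by (simp add: v(2) aw matrix_vector_right_distrib samples_kernel_combination K)
    ultimately show "z \<in> samples X ` closed_unit_ball F ip" by blast
  qed
qed

text \<open>
  The extremal \<open>f\<close> samples to \<open>S v\<close> with \<open>v\<close> the direction of \<open>S c\<close>. With \<^term>\<open>sgn (S *v c)\<close> as
  \<open>v\<close>, the degenerate case \<open>S c = 0\<close> takes \<open>v = 0\<close>.
\<close>

lemma linear_form_on_unit_ball:
  fixes X :: "'n::finite \<Rightarrow> 'x"
  shows "\<exists>f\<in>closed_unit_ball F ip. (c \<bullet> samples X f)\<^sup>2 = c \<bullet> (gram kern X *v c)"
    and "\<And>f. f \<in> closed_unit_ball F ip \<Longrightarrow> (c \<bullet> samples X f)\<^sup>2 \<le> c \<bullet> (gram kern X *v c)"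
proof -
  define S where "S = mat_sqrt (gram kern X)"
  have S: "transpose S = S" "S ** S = gram kern X"
    unfolding S_def using mat_sqrt_symmetric_root[OF pos_semidef_gram] by blast+
  note com = self_adjoint_commute[OF self_adjoint_matrix[OF S(1)]]
  have ball: "samples X ` closed_unit_ball F ip = (*v) S ` cball 0 1"
    unfolding S_def by (rule samples_unit_ball)
  have val: "c \<bullet> (gram kern X *v c) = (norm (S *v c))\<^sup>2"
    by (simp add: S(2)[symmetric] matrix_vector_mul_assoc[symmetric] com[symmetric] power2_norm_eq_inner)
  have "sgn (S *v c) \<in> cball 0 1" by (simp add: norm_sgn)
  then obtain f where f: "f \<in> closed_unit_ball F ip" "samples X f = S *v sgn (S *v c)"
    using ball by (metis (no_types, lifting) image_iff)
  have "c \<bullet> samples X f = norm (S *v c)"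
    by (cases "S *v c = 0")
      (simp_all add: f(2) com[symmetric] sgn_div_norm power2_norm_eq_inner[symmetric] power2_eq_square)
  then show "\<exists>f\<in>closed_unit_ball F ip. (c \<bullet> samples X f)\<^sup>2 = c \<bullet> (gram kern X *v c)"
    using f(1) by (intro bexI[of _ f]) (simp_all add: val)
  show "(c \<bullet> samples X g)\<^sup>2 \<le> c \<bullet> (gram kern X *v c)" if g: "g \<in> closed_unit_ball F ip" for g
  proof -
    have "samples X g \<in> (*v) S ` cball 0 1" using g ball by blast
    then obtain v where v: "norm v \<le> 1" "samples X g = S *v v" by auto
    have "(c \<bullet> samples X g)\<^sup>2 = ((S *v c) \<bullet> v)\<^sup>2" by (simp add: v(2) com)
    also have "\<dots> \<le> ((S *v c) \<bullet> (S *v c)) * (v \<bullet> v)" by (rule Cauchy_Schwarz_ineq)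
    also have "\<dots> \<le> ((S *v c) \<bullet> (S *v c)) * 1"
      using v(1) by (intro mult_left_mono) (simp_all add: norm_le_square flip: power2_norm_eq_inner)
    finally show ?thesis by (simp add: val power2_norm_eq_inner)
  qed
qed

text \<open>
  Positivity of \<open>A\<close> enters through \<open>lambda_max (S ** A ** S) \<ge> 0\<close>: it is needed to extend the bound
  from the unit sphere to the ball.
\<close>

lemma quadratic_form_on_unit_ball:
  fixes X :: "'n::finite \<Rightarrow> 'x"
  assumes A: "pos_semidef A"
  defines "S \<equiv> mat_sqrt (gram kern X)"
  shows "\<exists>f\<in>closed_unit_ball F ip. samples X f \<bullet> (A *v samples X f) = lambda_max (S ** A ** S)"
    and "\<And>f. f \<in> closed_unit_ball F ip \<Longrightarrow>
      samples X f \<bullet> (A *v samples X f) \<le> lambda_max (S ** A ** S)"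
proof -
  define M where "M = S ** A ** S"
  have S: "transpose S = S" unfolding S_def using mat_sqrt_symmetric_root[OF pos_semidef_gram] by blast
  have M: "transpose M = M"
    using A S by (simp add: M_def pos_semidef_def matrix_transpose_mul matrix_mul_assoc)
  have ball: "samples X ` closed_unit_ball F ip = (*v) S ` cball 0 1"
    unfolding S_def by (rule samples_unit_ball)
  have form: "(S *v v) \<bullet> (A *v (S *v v)) = v \<bullet> (M *v v)" for v
    by (simp add: M_def self_adjoint_commute[OF self_adjoint_matrix[OF S]]
        flip: matrix_vector_mul_assoc)
  obtain u where u: "norm u = 1" "u \<bullet> (M *v u) = lambda_max M"
    using lambda_max_quadratic_form(1)[OF M] by blast
  have "S *v u \<in> (*v) S ` cball 0 1" using u(1) by simp
  then obtain f where "f \<in> closed_unit_ball F ip" "samples X f = S *v u"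
    unfolding ball[symmetric] by auto
  then show "\<exists>f\<in>closed_unit_ball F ip. samples X f \<bullet> (A *v samples X f) = lambda_max (S ** A ** S)"
    using form[of u] u(2) by (intro bexI[of _ f]) (simp_all add: M_def)
  have "0 \<le> (S *v u) \<bullet> (A *v (S *v u))" using A by (simp add: pos_semidef_def)
  then have nonneg: "0 \<le> lambda_max M" by (simp add: form u(2))
  show "samples X g \<bullet> (A *v samples X g) \<le> lambda_max (S ** A ** S)"
    if g: "g \<in> closed_unit_ball F ip" for g
  proof -
    have "samples X g \<in> (*v) S ` cball 0 1" using g ball by blast
    then obtain v where v: "norm v \<le> 1" "samples X g = S *v v" by auto
    have "v \<bullet> (M *v v) \<le> lambda_max M * (norm v)\<^sup>2" by (rule lambda_max_quadratic_form(2)[OF M])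
    also have "\<dots> \<le> lambda_max M * 1"
      using v(1) nonneg by (intro mult_left_mono) (simp_all add: abs_square_le_1)
    finally show ?thesis using form[of v] by (simp add: v(2) M_def)
  qed
qed

end

section \<open>Attained maxima\<close>

lemma maximum_attained:
  assumes "a \<in> S" "\<And>b. b \<in> S \<Longrightarrow> \<phi> b \<le> \<phi> a"
  shows "has_maximum \<phi> S" "maximum \<phi> S = \<phi> a"
  using assms unfolding has_maximum_def maximum_def by (auto intro!: Greatest_equality)

text \<open>
  Exchanging the maximum over \<open>S\<close> with a finite one: the outer maximum is attained at the maximizer
  that belongs to the best index.
\<close>

lemma maximum_finite_family:
  fixes \<phi> :: "'i \<Rightarrow> 'b \<Rightarrow> real"
  assumes I: "finite I" "I \<noteq> {}" and r: "0 \<le> r"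
    and attained: "\<And>i. i \<in> I \<Longrightarrow> \<exists>a\<in>S. \<phi> i a = r * G i"
    and bound: "\<And>i a. i \<in> I \<Longrightarrow> a \<in> S \<Longrightarrow> \<phi> i a \<le> r * G i"
  shows "has_maximum (\<lambda>a. MAX i\<in>I. \<phi> i a) S"
    and "maximum (\<lambda>a. MAX i\<in>I. \<phi> i a) S = r * (MAX i\<in>I. G i)"
proof -
  have le: "(MAX i\<in>I. \<phi> i a) \<le> r * (MAX i\<in>I. G i)" if "a \<in> S" for a
  proof -
    have "\<phi> i a \<le> r * (MAX i\<in>I. G i)" if "i \<in> I" for i
      using bound[OF that \<open>a \<in> S\<close>] mult_left_mono[OF Max_ge r, of "G ` I" "G i"] I(1) that by simp
    then show ?thesis using I by simp
  qed
  have "(MAX i\<in>I. G i) \<in> G ` I" using I by simp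
  then obtain j where j: "j \<in> I" "(MAX i\<in>I. G i) = G j" by blast
  obtain a where a: "a \<in> S" "\<phi> j a = r * G j" using attained[OF j(1)] by blast
  have "r * (MAX i\<in>I. G i) \<le> (MAX i\<in>I. \<phi> i a)"
    unfolding j(2) a(2)[symmetric] using I(1) j(1) by (intro Max_ge) auto
  then have eq: "(MAX i\<in>I. \<phi> i a) = r * (MAX i\<in>I. G i)" using le[OF a(1)] by simp
  show "has_maximum (\<lambda>a. MAX i\<in>I. \<phi> i a) S"
    and "maximum (\<lambda>a. MAX i\<in>I. \<phi> i a) S = r * (MAX i\<in>I. G i)"
    using maximum_attained[OF a(1), of "\<lambda>a. MAX i\<in>I. \<phi> i a"] le by (simp_all add: eq)
qed

section \<open>Imbalance and matching matrices\<close>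

lemma quadratic_form_sum:
  fixes A :: "real^'n^'n"
  shows "(\<Sum>i\<in>UNIV. \<Sum>j\<in>UNIV. x $ i * A $ i $ j * x $ j) = x \<bullet> (A *v x)"
  by (simp add: inner_vec_def matrix_vector_mult_def sum_distrib_left mult.assoc)

text \<open>
  With \<open>s\<^sub>k\<close> the sum of the \<open>x\<^sub>i\<close> in group \<open>k\<close>, the form equals
  \<open>(m \<Sum>\<^sub>k s\<^sub>k\<^sup>2 - (\<Sum>\<^sub>k s\<^sub>k)\<^sup>2) / (m - 1)\<close>, which is nonnegative by Cauchy-Schwarz over the \<open>m\<close> groups.
\<close>

lemma matching_quadratic_form:
  fixes W :: "'n::finite \<Rightarrow> nat"
  assumes "m \<ge> 2" "range W \<subseteq> {1..m}"
  shows "0 \<le> (\<Sum>i\<in>UNIV. \<Sum>j\<in>UNIV.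
    x i * (if W i = W j then 1 else - 1 / (real m - 1)) * x j)"
proof -
  define s where "s k = (\<Sum>i\<in>UNIV. if W i = k then x i else 0)" for k
  have W: "W i \<in> {1..m}" for i using assms(2) by blast
  have collapse: "(\<Sum>k\<in>{1..m}. \<Sum>i\<in>UNIV. if W i = k then g i k else 0) = (\<Sum>i\<in>UNIV. g i (W i))"
    for g :: "'n \<Rightarrow> nat \<Rightarrow> real"
    by (subst sum.swap) (use W in simp)
  have total: "(\<Sum>k\<in>{1..m}. s k) = (\<Sum>i\<in>UNIV. x i)"
    unfolding s_def by (rule collapse)
  have diag: "(\<Sum>k\<in>{1..m}. (s k)\<^sup>2) = (\<Sum>i\<in>UNIV. \<Sum>j\<in>UNIV. if W i = W j then x i * x j else 0)"
  proof -
    have "(s k)\<^sup>2 = (\<Sum>i\<in>UNIV. if W i = k then x i * s k else 0)" for k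
      unfolding power2_eq_square s_def[of k] sum_distrib_right by (intro sum.cong) auto
    then have "(\<Sum>k\<in>{1..m}. (s k)\<^sup>2) = (\<Sum>i\<in>UNIV. x i * s (W i))"
      by (simp only: collapse)
    also have "\<dots> = (\<Sum>i\<in>UNIV. \<Sum>j\<in>UNIV. if W i = W j then x i * x j else 0)"
      unfolding s_def sum_distrib_left by (intro sum.cong) auto
    finally show ?thesis .
  qed
  have "(real m - 1) * (\<Sum>i\<in>UNIV. \<Sum>j\<in>UNIV. x i * (if W i = W j then 1 else - 1 / (real m - 1)) * x j)
    = (\<Sum>i\<in>UNIV. \<Sum>j\<in>UNIV. real m * (if W i = W j then x i * x j else 0) - x i * x j)"
    unfolding sum_distrib_left using assms(1) by (intro sum.cong) (auto simp: field_simps)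
  also have "\<dots> = real m * (\<Sum>k\<in>{1..m}. (s k)\<^sup>2) - (\<Sum>k\<in>{1..m}. s k)\<^sup>2"
    unfolding diag total power2_eq_square[of "sum x UNIV"] sum_product
    by (simp add: sum_subtractf sum_distrib_left)
  also have "\<dots> \<ge> 0"
    using sum_squared_le_sum_of_squares[of s "{1..m}"] by (simp add: mult.commute)
  finally show ?thesis using assms(1) by (simp add: zero_le_mult_iff)
qed

text \<open>
  The entries of \<^term>\<open>Q_matrix m \<sigma>\<close> are expectations of those of the matrices in the preceding
  lemma, and positivity passes to the average.
\<close>

lemma pos_semidef_Q_matrix:
  fixes \<sigma> :: "('n::finite \<Rightarrow> nat) pmf"
  assumes "m \<ge> 2" and sup: "\<And>W. W \<in> set_pmf \<sigma> \<Longrightarrow> range W \<subseteq> {1..m}"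
  shows "pos_semidef (Q_matrix m \<sigma>)"
proof -
  define q where "q W i j = (if W i = W j then 1 else - 1 / (real m - 1))" for W :: "'n \<Rightarrow> nat" and i j
  have int: "integrable (measure_pmf \<sigma>) (\<lambda>W. q W i j)" for i j
    by (rule measure_pmf.integrable_const_bound[where B = "\<bar>1\<bar> + \<bar>1 / (real m - 1)\<bar>"]) (auto simp: q_def)
  have Q: "Q_matrix m \<sigma> $ i $ j = measure_pmf.expectation \<sigma> (\<lambda>W. q W i j)" for i j
  proof -
    have q: "q W i j = indicator {W. W i = W j} W - 1 / (real m - 1) * indicator {W. W i \<noteq> W j} W" for W
      by (simp add: q_def indicator_def)
    have "integrable (measure_pmf \<sigma>) (indicator A :: _ \<Rightarrow> real)" for A
      by (rule measure_pmf.integrable_const_bound[where B = 1]) auto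
    then show ?thesis unfolding q by (simp add: Q_matrix_def)
  qed
  have "0 \<le> v \<bullet> (Q_matrix m \<sigma> *v v)" for v
  proof -
    have "v \<bullet> (Q_matrix m \<sigma> *v v) =
      measure_pmf.expectation \<sigma> (\<lambda>W. \<Sum>i\<in>UNIV. \<Sum>j\<in>UNIV. v $ i * q W i j * v $ j)"
      by (simp add: quadratic_form_sum[symmetric] Q int)
    also have "\<dots> \<ge> 0"
      unfolding q_def using matching_quadratic_form[OF assms(1) sup]
      by (intro integral_nonneg_AE) (simp add: AE_measure_pmf_iff)
    finally show ?thesis .
  qed
  moreover have "transpose (Q_matrix m \<sigma>) = Q_matrix m \<sigma>"
    by (simp add: vec_eq_iff transpose_def Q_matrix_def eq_commute)
  ultimately show ?thesis by (simp add: pos_semidef_def)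
qed

lemma imbalance_samples:
  "imbalance p X W f k k' =
     1 / real p * ((\<chi> i. treatment_ind W i k - treatment_ind W i k') \<bullet> samples X f)"
proof -
  have "(\<Sum>i | W i = k. f (X i)) = (\<Sum>i\<in>UNIV. treatment_ind W i k * f (X i))" for k
    by (rule sum.mono_neutral_cong_left) (auto simp: treatment_ind_def)
  then show ?thesis
    unfolding imbalance_def
    by (simp add: inner_vec_def samples_def left_diff_distrib sum_subtractf diff_divide_distrib)
qed

section \<open>The two extremal imbalances\<close>

theorem theorem6:
  fixes F :: "('x \<Rightarrow> real) set"
    and ip :: "('x \<Rightarrow> real) \<Rightarrow> ('x \<Rightarrow> real) \<Rightarrow> real"
    and kern :: "'x \<Rightarrow> 'x \<Rightarrow> real"
    and X :: "'n::finite \<Rightarrow> 'x"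
    and m p :: nat
  assumes "rkhs F ip kern"
    and "m \<ge> 2"
    and "CARD('n) = m * p"
  shows "(\<forall>W \<in> assignments m p.
            has_maximum (worst_imbalance_sq m p X W) (closed_unit_ball F ip) \<and>
            M_P_sq F ip m p X W =
              1 / (real p)\<^sup>2 *
              (MAX (k, k')\<in>treatment_pairs m.
                 \<Sum>i\<in>UNIV. \<Sum>j\<in>UNIV.
                   (treatment_ind W i k - treatment_ind W i k') * gram kern X $ i $ j *
                   (treatment_ind W j k - treatment_ind W j k'))) \<and>
         (\<forall>\<sigma> \<in> blind_designs m p.
            has_maximum (mixed_imbalance p X (Q_matrix m \<sigma>)) (closed_unit_ball F ip) \<and>
            M_M_sq F ip p X (Q_matrix m \<sigma>) =
              2 / (real CARD('n) * real p) *
              lambda_max (mat_sqrt (gram kern X) ** Q_matrix m \<sigma> ** mat_sqrt (gram kern X)))"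
proof (intro conjI ballI)
  interpret rkhs F ip kern by (rule assms(1))
  let ?ball = "closed_unit_ball F ip"
  fix W :: "'n \<Rightarrow> nat"
  define c :: "nat \<times> nat \<Rightarrow> real^'n"
    where "c = (\<lambda>(k, k'). \<chi> i. treatment_ind W i k - treatment_ind W i k')"
  define \<phi> where "\<phi> = (\<lambda>(k, k') f. (imbalance p X W f k k')\<^sup>2)"
  define G where "G = (\<lambda>(k, k'). \<Sum>i\<in>UNIV. \<Sum>j\<in>UNIV.
    (treatment_ind W i k - treatment_ind W i k') * gram kern X $ i $ j *
    (treatment_ind W j k - treatment_ind W j k'))"
  have \<phi>: "\<phi> q f = 1 / (real p)\<^sup>2 * (c q \<bullet> samples X f)\<^sup>2" for q f
    by (cases q) (simp add: \<phi>_def c_def imbalance_samples power_divide)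
  have G: "G q = c q \<bullet> (gram kern X *v c q)" for q
    by (cases q) (simp add: G_def c_def flip: quadratic_form_sum)
  have "treatment_pairs m \<subseteq> {1..m} \<times> {1..m}" by (auto simp: treatment_pairs_def)
  then have fin: "finite (treatment_pairs m)" by (rule finite_subset) simp
  have "(1, 2) \<in> treatment_pairs m" using assms(2) by (simp add: treatment_pairs_def)
  then have ne: "treatment_pairs m \<noteq> {}" by blast
  have worst: "worst_imbalance_sq m p X W = (\<lambda>f. MAX q\<in>treatment_pairs m. \<phi> q f)"
    by (simp add: fun_eq_iff worst_imbalance_sq_def \<phi>_def case_prod_unfold)
  have attained: "\<exists>f\<in>?ball. \<phi> q f = 1 / (real p)\<^sup>2 * G q" for q
    using linear_form_on_unit_ball(1)[of "c q" X] by (auto simp: \<phi> G)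
  have bound: "\<phi> q f \<le> 1 / (real p)\<^sup>2 * G q" if "f \<in> ?ball" for q f
    using linear_form_on_unit_ball(2)[OF that, of "c q" X] by (simp add: \<phi> G divide_right_mono)
  note max = maximum_finite_family[OF fin ne _ attained bound]
  show "has_maximum (worst_imbalance_sq m p X W) ?ball"
    unfolding worst by (rule max) simp_all
  show "M_P_sq F ip m p X W =
      1 / (real p)\<^sup>2 *
      (MAX (k, k')\<in>treatment_pairs m.
         \<Sum>i\<in>UNIV. \<Sum>j\<in>UNIV.
           (treatment_ind W i k - treatment_ind W i k') * gram kern X $ i $ j *
           (treatment_ind W j k - treatment_ind W j k'))"
    unfolding M_P_sq_def worst G_def[symmetric] by (rule max) simp_all
next
  interpret rkhs F ip kern by (rule assms(1))
  let ?ball = "closed_unit_ball F ip"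
  fix \<sigma> :: "('n \<Rightarrow> nat) pmf"
  assume \<sigma>: "\<sigma> \<in> blind_designs m p"
  define Q where "Q = Q_matrix m \<sigma>"
  define l where "l = lambda_max (mat_sqrt (gram kern X) ** Q ** mat_sqrt (gram kern X))"
  have "range W \<subseteq> {1..m}" if "W \<in> set_pmf \<sigma>" for W
    using \<sigma> that by (auto simp: blind_designs_def assignments_def)
  then have Q: "pos_semidef Q" unfolding Q_def using assms(2) by (intro pos_semidef_Q_matrix)
  have mixed: "mixed_imbalance p X Q f =
      2 / (real CARD('n) * real p) * (samples X f \<bullet> (Q *v samples X f))" for f
    by (simp add: mixed_imbalance_def samples_def mult_ac flip: quadratic_form_sum)
  obtain f where f: "f \<in> ?ball" "samples X f \<bullet> (Q *v samples X f) = l"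
    unfolding l_def using quadratic_form_on_unit_ball(1)[OF Q] by blast
  have bound: "mixed_imbalance p X Q g \<le> mixed_imbalance p X Q f" if "g \<in> ?ball" for g
    unfolding mixed f(2) l_def
    by (intro mult_left_mono quadratic_form_on_unit_ball(2)[OF Q that]) simp
  note max = maximum_attained[of f ?ball "mixed_imbalance p X Q", OF f(1) bound]
  show "has_maximum (mixed_imbalance p X (Q_matrix m \<sigma>)) ?ball"
    unfolding Q_def[symmetric] by (rule max)
  show "M_M_sq F ip p X (Q_matrix m \<sigma>) =
      2 / (real CARD('n) * real p) *
      lambda_max (mat_sqrt (gram kern X) ** Q_matrix m \<sigma> ** mat_sqrt (gram kern X))"
    unfolding M_M_sq_def Q_def[symmetric] l_def[symmetric]
    using max(2) by (simp add: mixed f(2))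
qed

end
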